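(* Let $d\in\{2,3\}$, $\mathcal{M}\subset\mathbb{R}^d$, $T>0$, and let $\mathbf{F}:\mathcal{M}\to\mathbb{R}^n$ be the descriptor map, with Jacobian $J_{\mathbf{F}}$. Let $\mathbf{p}:[0,T]\to\mathcal{M}$ be the true $\mathcal{C}^1$ trajectory and $\mathbf{q}:[0,T]\to\mathcal{M}$ a candidate trajectory, and let $$\mathcal{W}(0,T):=\int_0^TJ_{\mathbf{F}}(\mathbf{p}(t))^\top J_{\mathbf{F}}(\mathbf{p}(t))\,\mathrm{d}t\in\mathbb{R}^{d\times d}.$$ Assume: (T1) $\dot{\mathbf{p}}(t)=\dot{\mathbf{q}}(t)=\mathbf{v}(t)$ for all $t\in[0,T]$, so that $\boldsymbol\delta_0:=\mathbf{p}(0)-\mathbf{q}(0)=\mathbf{p}(t)-\mathbf{q}(t)$ is constant; (T2) $\sup_t\|J_{\mathbf{F}}(\mathbf{p}(t))\|_{\mathrm{op}}\le L$; (T3) $\|J_{\mathbf{F}}(\mathbf{p})-J_{\mathbf{F}}(\mathbf{q})\|_{\mathrm{op}}\le\Lambda\|\mathbf{p}-\mathbf{q}\|_2$ for all $\mathbf{p},\mathbf{q}$ on the trajectory; (T4) $\lambda_{\min}(\mathcal{W}(0,T))\ge\mu_T>0$; (T5) $\|\boldsymbol\delta_0\|_2\le\mu_T/(\Lambda LT)$. Then $$\|\mathbf{p}(0)-\mathbf{q}(0)\|_2\le\frac{2L}{\mu_T}\int_0^T\|\mathbf{F}(\mathbf{p}(t))-\mathbf{F}(\mathbf{q}(t))\|_2\,\mathrm{d}t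 .$$ In particular, if $\mathbf{F}(\mathbf{p}(t))=\mathbf{F}(\mathbf{q}(t))$ for all $t\in[0,T]$, then $\mathbf{p}(0)=\mathbf{q}(0)$.
   Context: The descriptor map is $\mathbf{F}(\mathbf{p})=[\phi_1(\mathbf{p}),\dots,\phi_n(\mathbf{p})]^\top$ with $\phi_i(\mathbf{p})=\int_{\mathbb{S}^{d-1}}f_{\mathbf{p}}w_i\,\mathrm{d}\sigma$, where $\sigma$ is the surface measure on the unit sphere $\mathbb{S}^{d-1}$, $f_{\mathbf{p}}:\mathbb{S}^{d-1}\to\mathbb{R}$ is the environment signal at $\mathbf{p}\in\mathcal{M}$, and $w_i(\boldsymbol\theta)=\exp(\boldsymbol\theta^\top\mathbf{d}_i/\varepsilon)/\sum_{j=1}^n\exp(\boldsymbol\theta^\top\mathbf{d}_j/\varepsilon)$ for fixed unit vectors $\mathbf{d}_1,\dots,\mathbf{d}_n$ and $\varepsilon>0$. The signal is assumed such that $\mathbf{F}$ is Fréchet differentiable on $\mathcal{M}$: for $\sigma$-a.e. $\boldsymbol\theta$ the map $\mathbf{p}\mapsto f_{\mathbf{p}}(\boldsymbol\theta)$ is differentiable on $\mathcal{M}$, with $\|\nabla_{\mathbf{p}}f_{\mathbf{p}}(\boldsymbol\theta)\|_2\le h(\boldsymbol\theta)$ for all $\mathbf{p}\in\mathcal{M}$ and some $h\in L^1(\mathbb{S}^{d-1})$. $J_{\mathbf{F}}(\mathbf{p})\in\mathbb{R}^{n\times d}$ is the Jacobian; $\|\cdot\|_{\mathrm{op}}$ is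 the operator norm for Euclidean norms; $\lambda_{\min}$ is the smallest eigenvalue of a symmetric matrix. $\mathcal{W}(0,T)$ is called the observability Gramian.
   Formalization: (T3) is required for all points of each segment from p(t) to q(t), and these segments are assumed to lie in M; with (T3) only at trajectory points the claim fails, e.g. F(x,y)=(cos x, sin x, cos y, sin y), p≡(2π,0), q≡(0,0), Λ=1/(2π). *)

theory Defs
  imports "HOL-Analysis.Analysis"
begin

text \<open>
  Surface measure on the unit sphere, on the Borel sets of the sphere. It is defined by the usual
  polar-coordinate normalisation: a Borel set \<open>A\<close> of the sphere gets
  \<open>DIM('a)\<close> times the Lebesgue measure of the solid cone of all \<open>x\<close> with
  \<open>0 < norm x \<le> 1\<close> and \<open>x / norm x \<in> A\<close>; recall that
  \<open>sgn x = x /\<^sub>R norm x\<close>.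
\<close>

definition sphere_measure :: "'a::euclidean_space measure" where
  "sphere_measure =
     scale_measure (of_nat DIM('a))
       (distr (restrict_space lborel (cball 0 1 - {0})) (restrict_space borel (sphere 0 1)) sgn)"

lemma space_sphere_measure [simp]: "space sphere_measure = sphere 0 1"
  by (simp add: sphere_measure_def space_scale_measure space_restrict_space)

lemma sets_sphere_measure [measurable_cong]:
  "sets sphere_measure = sets (restrict_space borel (sphere 0 1))"
  by (simp add: sphere_measure_def)

lemma emeasure_sphere_measure:
  fixes A :: "'a::euclidean_space set"
  assumes "A \<in> sets borel" "A \<subseteq> sphere 0 1"
  shows "emeasure sphere_measure A =
    of_nat DIM('a) * emeasure lborel {x \<in> cball 0 1 - {0}. sgn x \<in> A}"
proof -
  let ?C = "cball 0 1 - {0} :: 'a set"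
  have C: "?C \<in> sets lborel" by simp
  have sgn: "sgn \<in> measurable (restrict_space lborel ?C) (restrict_space borel (sphere 0 1))"
  proof (rule measurable_restrict_space2)
    show "sgn \<in> space (restrict_space lborel ?C) \<rightarrow> sphere 0 1"
      by (auto simp: space_restrict_space norm_sgn)
    have "sgn = (\<lambda>x::'a. x /\<^sub>R norm x)"
      by (simp add: fun_eq_iff sgn_div_norm)
    then show "sgn \<in> borel_measurable (restrict_space lborel ?C)"
      by (intro measurable_restrict_space1) simp
  qed
  have A: "A \<in> sets (restrict_space borel (sphere 0 1))"
    using assms by (auto simp: sets_restrict_space_iff)
  have eq: "sgn -` A \<inter> space (restrict_space lborel ?C) = {x \<in> ?C. sgn x \<in> A}"
    by (auto simp: space_restrict_space)
  have "emeasure sphere_measure A =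
      of_nat DIM('a) * emeasure (restrict_space lborel ?C) {x \<in> ?C. sgn x \<in> A}"
    using emeasure_distr[OF sgn A] eq by (simp add: sphere_measure_def)
  also have "emeasure (restrict_space lborel ?C) {x \<in> ?C. sgn x \<in> A} =
      emeasure lborel {x \<in> ?C. sgn x \<in> A}"
    by (rule emeasure_restrict_space) auto
  finally show ?thesis .
qed

definition window ::
  "real \<Rightarrow> ('n::finite \<Rightarrow> 'a::euclidean_space) \<Rightarrow> 'n \<Rightarrow> 'a \<Rightarrow> real" where
  "window \<epsilon> dir i \<theta> = exp (\<theta> \<bullet> dir i / \<epsilon>) / (\<Sum>j\<in>UNIV. exp (\<theta> \<bullet> dir j / \<epsilon>))"

definition descriptor_map ::
  "real \<Rightarrow> ('n::finite \<Rightarrow> 'a::euclidean_space) \<Rightarrow> ('a \<Rightarrow> 'a \<Rightarrow> real) \<Rightarrow> 'a \<Rightarrow> real ^ 'n" where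
  "descriptor_map \<epsilon> dir f x = (\<chi> i. \<integral>\<theta>. f x \<theta> * window \<epsilon> dir i \<theta> \<partial>sphere_measure)"

text \<open>
  The integrability of \<open>f x\<close> is what makes the descriptor integrals meaningful; the windows
  are continuous and positive on the sphere, so it is the same as integrability of all the products.
  Derivatives are taken within \<open>M\<close>, so only values of the signal on \<open>M\<close> matter.
\<close>

definition dominated_signal :: "'a::euclidean_space set \<Rightarrow> ('a \<Rightarrow> 'a \<Rightarrow> real) \<Rightarrow> bool" where
  "dominated_signal M f \<longleftrightarrow>
     (\<forall>x\<in>M. integrable sphere_measure (f x)) \<and>
     (\<exists>h. integrable sphere_measure h \<and>
       (AE \<theta> in sphere_measure. \<forall>x\<in>M. \<exists>g.
          ((\<lambda>y. f y \<theta>) has_derivative (\<lambda>v. g \<bullet> v)) (at x within M) \<and> norm g \<le> h \<theta>))"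

text \<open>
  A Jacobian exists exactly if \<open>F\<close> is \<open>differentiable_on M\<close>. It is unique at interior
  points of \<open>M\<close>, but not in general on a thin set, so it is a relation and not a function.
\<close>

definition is_jacobian_on ::
  "(real ^ 'd::finite) set \<Rightarrow> (real ^ 'd \<Rightarrow> real ^ 'n::finite) \<Rightarrow> (real ^ 'd \<Rightarrow> real ^ 'd ^ 'n) \<Rightarrow> bool"
where
  "is_jacobian_on M F J \<longleftrightarrow> (\<forall>x\<in>M. (F has_derivative (\<lambda>v. J x *v v)) (at x within M))"

abbreviation op_norm :: "real ^ 'd::finite ^ 'n::finite \<Rightarrow> real" where
  "op_norm A \<equiv> onorm (\<lambda>v. A *v v)"

text \<open>Only meant for symmetric matrices, where the set is finite and nonempty.\<close>

definition lambda_min :: "real ^ 'd::finite ^ 'd \<Rightarrow> real" where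
  "lambda_min A = Min {l. \<exists>v. v \<noteq> 0 \<and> A *v v = l *\<^sub>R v}"

definition gramian ::
  "(real ^ 'd::finite \<Rightarrow> real ^ 'd ^ 'n::finite) \<Rightarrow> (real \<Rightarrow> real ^ 'd) \<Rightarrow> real \<Rightarrow> real ^ 'd ^ 'd" where
  "gramian J p T = integral {0..T} (\<lambda>t. transpose (J (p t)) ** J (p t))"

end

theory Submission
  imports Defs
begin

text \<open>
  With the constant offset \<open>\<delta> = p t - q t\<close>, Taylor expansion along the segment from
  \<open>q t\<close> to \<open>p t\<close> gives \<open>norm (J (p t) *v \<delta>) \<le> norm (F (p t) - F (q t)) + \<Lambda> * (norm \<delta>)\<^sup>2 / 2\<close>.
  Multiplying by \<open>norm (J (p t) *v \<delta>) \<le> L * norm \<delta>\<close> and integrating, the left-hand side becomes the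
  quadratic form of the Gramian at \<open>\<delta>\<close>, which is at least \<open>\<mu> * (norm \<delta>)\<^sup>2\<close>, while by (T5) the
  quadratic remainder is at most half of that and can be absorbed.
\<close>

section \<open>Smallest eigenvalue and quadratic form of a symmetric matrix\<close>

lemma symmetric_matrix_inner:
  fixes A :: "real ^ 'd ^ 'd::finite"
  assumes "transpose A = A"
  shows "x \<bullet> (A *v y) = (A *v x) \<bullet> y"
  by (metis assms dot_lmul_matrix transpose_matrix_vector)

text \<open>Eigenvectors for distinct eigenvalues are orthogonal, so one eigenvector per eigenvalue
  gives an independent family. Finiteness is what gives the \<open>Min\<close> in
  \<open>lambda_min\<close> its meaning as a lower bound of the set.\<close>

lemma finite_eigenvalues_symmetric:
  fixes A :: "real ^ 'd ^ 'd::finite"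
  assumes sym: "transpose A = A"
  shows "finite {l. \<exists>v. v \<noteq> 0 \<and> A *v v = l *\<^sub>R v}"
proof -
  define E where "E = {l. \<exists>v. v \<noteq> 0 \<and> A *v v = l *\<^sub>R v}"
  have "\<forall>l\<in>E. \<exists>v. v \<noteq> 0 \<and> A *v v = l *\<^sub>R v"
    by (simp add: E_def)
  from bchoice[OF this] obtain e where e: "\<forall>l\<in>E. e l \<noteq> 0 \<and> A *v e l = l *\<^sub>R e l" ..
  have orth: "e k \<bullet> e l = 0" if "k \<in> E" "l \<in> E" "k \<noteq> l" for k l
  proof -
    have "l * (e k \<bullet> e l) = k * (e k \<bullet> e l)"
      using symmetric_matrix_inner[OF sym, of "e k" "e l"] e that by simp
    then show ?thesis
      using that(3) by simp
  qed
  \<comment> \<open>An eigenvector shared by two distinct eigenvalues would be orthogonal to itself,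
    hence zero.\<close>
  have "inj_on e E"
    using e orth by (metis inj_onI inner_eq_zero_iff)
  moreover have "finite (e ` E)"
  proof (rule independent_imp_finite, rule pairwise_orthogonal_independent)
    show "pairwise orthogonal (e ` E)"
      unfolding pairwise_def orthogonal_def using orth by blast
    show "0 \<notin> e ` E"
      using e by force
  qed
  ultimately show ?thesis
    using finite_image_iff unfolding E_def by blast
qed

text \<open>The minimum of the quadratic form on the unit sphere is an eigenvalue.\<close>

lemma lambda_min_le_quadratic_form:
  fixes A :: "real ^ 'd ^ 'd::finite"
  assumes sym: "transpose A = A"
  shows "lambda_min A * (norm x)\<^sup>2 \<le> x \<bullet> (A *v x)"
proof -
  let ?S = "sphere 0 1 :: (real ^ 'd) set"
  have "continuous_on ?S (\<lambda>v. v \<bullet> (A *v v))"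
    by (intro continuous_intros linear_continuous_on matrix_vector_mul_bounded_linear)
  then obtain u where u: "u \<in> ?S" and min: "\<And>v. v \<in> ?S \<Longrightarrow> u \<bullet> (A *v u) \<le> v \<bullet> (A *v v)"
    using continuous_attains_inf[OF compact_sphere, of 0 1 "\<lambda>v. v \<bullet> (A *v v)"] by auto
  define m where "m = u \<bullet> (A *v u)"
  have nu: "norm u = 1" "u \<bullet> u = 1"
    using u by (simp_all add: dot_square_norm)
  have bound: "m * (v \<bullet> v) \<le> v \<bullet> (A *v v)" for v
  proof (cases "v = 0")
    case False
    define w where "w = (1 / norm v) *\<^sub>R v"
    have w: "v = norm v *\<^sub>R w" "w \<in> ?S"
      using False by (simp_all add: w_def)
    have "v \<bullet> (A *v v) = (norm v)\<^sup>2 * (w \<bullet> (A *v w))"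
      by (subst (1 2) w(1)) (simp add: matrix_vector_mult_scaleR power2_eq_square)
    moreover have "(norm v)\<^sup>2 * m \<le> (norm v)\<^sup>2 * (w \<bullet> (A *v w))"
      using min[OF w(2)] by (intro mult_left_mono) (auto simp: m_def)
    ultimately show ?thesis
      by (simp add: dot_square_norm mult.commute)
  qed simp
  define r where "r = A *v u - m *\<^sub>R u"
  have ru: "r \<bullet> u = 0"
    using nu by (simp add: r_def m_def inner_diff_left inner_diff_right inner_commute)
  \<comment> \<open>Moving from \<open>u\<close> by \<open>- s *\<^sub>R r\<close> would decrease the form to first order in \<open>s\<close> if \<open>r \<noteq> 0\<close>.\<close>
  have "r = 0"
  proof (rule ccontr)
    assume "r \<noteq> 0"
    define a where "a = r \<bullet> r"
    define b where "b = r \<bullet> (A *v r) - m * a"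
    have a: "a > 0"
      using \<open>r \<noteq> 0\<close> by (simp add: a_def)
    have Au: "A *v u = r + m *\<^sub>R u"
      by (simp add: r_def)
    \<comment> \<open>This is \<open>bound\<close> at \<open>u - s *\<^sub>R r\<close>: both sides
      are expanded and the constant terms \<open>m\<close> cancel.\<close>
    have quad: "0 \<le> s\<^sup>2 * b - 2 * s * a" for s
    proof -
      have "u \<bullet> (A *v r) = r \<bullet> (A *v u)"
        using symmetric_matrix_inner[OF sym, of u r] by (simp add: inner_commute)
      then have Ar: "u \<bullet> (A *v r) = a" "r \<bullet> (A *v u) = a" "u \<bullet> (A *v u) = m"
        using ru nu by (simp_all add: Au a_def inner_add_right inner_commute)
      have "(u - s *\<^sub>R r) \<bullet> (A *v (u - s *\<^sub>R r)) = m - 2 * s * a + s\<^sup>2 * (r \<bullet> (A *v r))"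
        using Ar by (simp add: matrix_vector_mult_diff_distrib matrix_vector_mult_scaleR inner_diff_left
            inner_diff_right power2_eq_square algebra_simps)
      moreover have "(u - s *\<^sub>R r) \<bullet> (u - s *\<^sub>R r) = 1 + s\<^sup>2 * a"
        using ru nu by (simp add: inner_diff_left inner_diff_right a_def inner_commute power2_eq_square)
      ultimately show ?thesis
        using bound[of "u - s *\<^sub>R r"] by (simp add: b_def algebra_simps)
    qed
    \<comment> \<open>Small enough that \<open>s * b \<le> a < 2 * a\<close>, so the linear term
      wins in \<open>quad\<close>; the \<open>+ 1\<close> keeps the denominator positive when
      \<open>b = 0\<close>.\<close>
    define s where "s = a / (\<bar>b\<bar> + 1)"
    have s: "s > 0"
      using a by (simp add: s_def add_nonneg_pos)
    have "s * b < 2 * a"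
    proof -
      have "s * (\<bar>b\<bar> + 1) = a"
        by (simp add: s_def)
      moreover have "s * b \<le> s * (\<bar>b\<bar> + 1)"
        using s by (intro mult_left_mono) auto
      ultimately show ?thesis
        using a by linarith
    qed
    then have "s * (s * b) < s * (2 * a)"
      using s by (rule mult_strict_left_mono)
    then show False
      using quad[of s] by (simp add: power2_eq_square algebra_simps)
  qed
  then have "m \<in> {l. \<exists>v. v \<noteq> 0 \<and> A *v v = l *\<^sub>R v}"
    using nu by (intro CollectI exI[of _ u]) (auto simp: r_def)
  then have "lambda_min A \<le> m"
    unfolding lambda_min_def by (rule Min_le[OF finite_eigenvalues_symmetric[OF sym]])
  then have "lambda_min A * (norm x)\<^sup>2 \<le> m * (norm x)\<^sup>2"
    by (intro mult_right_mono) auto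
  also have "\<dots> \<le> x \<bullet> (A *v x)"
    using bound[of x] by (simp add: dot_square_norm)
  finally show ?thesis .
qed

section \<open>Integrability, quadratic form and symmetry of the Gramian\<close>

lemma lambda_min_zero: "lambda_min (0 :: real ^ 'd ^ 'd::finite) = 0"
proof -
  obtain v :: "real ^ 'd" where "v \<noteq> 0"
    by (metis zero_neq_one)
  then have "{l. \<exists>v::real ^ 'd. v \<noteq> 0 \<and> (0 :: real ^ 'd ^ 'd) *v v = l *\<^sub>R v} = {0}"
    by auto
  then show ?thesis
    unfolding lambda_min_def by (simp only: Min_singleton)
qed

text \<open>
  The integral of a non-integrable function is \<open>0\<close>, so that a Gramian with a non-integrable
  integrand would have smallest eigenvalue \<open>0\<close>.
\<close>

lemma gramian_integrable:
  assumes "lambda_min (gramian J p T) > 0"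
  shows "(\<lambda>t. transpose (J (p t)) ** J (p t)) integrable_on {0..T}"
proof (rule ccontr)
  assume "\<not> ?thesis"
  then have "gramian J p T = 0"
    unfolding gramian_def by (rule not_integrable_integral)
  then show False
    using assms by (simp add: lambda_min_zero)
qed

text \<open>For fixed \<open>x\<close> the form \<open>x \<bullet> (A *v x)\<close> is linear in
  \<open>A\<close>, so it commutes with the integral; on a product \<open>transpose B ** B\<close>
  it is the squared norm of \<open>B *v x\<close>.\<close>

lemma has_integral_gramian_quadratic_form:
  fixes J :: "real ^ 'd::finite \<Rightarrow> real ^ 'd ^ 'n::finite"
  assumes "(\<lambda>t. transpose (J (p t)) ** J (p t)) integrable_on {0..T}"
  shows "((\<lambda>t. (norm (J (p t) *v x))\<^sup>2) has_integral x \<bullet> (gramian J p T *v x)) {0..T}"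
proof -
  have "linear (\<lambda>A::real ^ 'd ^ 'd. x \<bullet> (A *v x))"
    by (rule linearI)
       (simp_all add: matrix_vector_mult_add_rdistrib inner_add_right flip: scaleR_matrix_vector_assoc)
  then have "bounded_linear (\<lambda>A::real ^ 'd ^ 'd. x \<bullet> (A *v x))"
    by (simp add: linear_conv_bounded_linear)
  from has_integral_linear[OF integrable_integral[OF assms] this]
  have "((\<lambda>t. x \<bullet> ((transpose (J (p t)) ** J (p t)) *v x)) has_integral
      x \<bullet> (gramian J p T *v x)) {0..T}"
    by (simp add: gramian_def o_def)
  moreover have "x \<bullet> ((transpose B ** B) *v x) = (norm (B *v x))\<^sup>2" for B :: "real ^ 'd ^ 'n"
    by (metis dot_lmul_matrix dot_square_norm inner_commute matrix_vector_mul_assoc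
        transpose_matrix_vector)
  ultimately show ?thesis
    by simp
qed

lemma transpose_gramian:
  fixes J :: "real ^ 'd::finite \<Rightarrow> real ^ 'd ^ 'n::finite"
  assumes "(\<lambda>t. transpose (J (p t)) ** J (p t)) integrable_on {0..T}"
  shows "transpose (gramian J p T) = gramian J p T"
proof -
  have "linear (transpose :: real ^ 'd ^ 'd \<Rightarrow> real ^ 'd ^ 'd)"
    by (rule linearI) (simp_all add: transpose_def vec_eq_iff)
  then have "bounded_linear (transpose :: real ^ 'd ^ 'd \<Rightarrow> real ^ 'd ^ 'd)"
    by (simp add: linear_conv_bounded_linear)
  from integral_linear[OF assms this] show ?thesis
    by (simp add: gramian_def o_def matrix_transpose_mul)
qed

section \<open>First-order Taylor expansion with quadratic remainder\<close>

lemma norm_matrix_vector_le_op_norm: "norm (A *v x) \<le> op_norm A * norm x"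
  by (rule onorm[OF matrix_vector_mul_bounded_linear])

text \<open>Along the segment the remainder has a derivative growing at most linearly in the
  parameter, which yields the factor 1/2. A mean value inequality replaces integration of the
  derivative, so \<open>J\<close> need not be integrable along the segment.\<close>

lemma jacobian_taylor_remainder:
  fixes F :: "real ^ 'd::finite \<Rightarrow> real ^ 'n::finite"
  assumes J: "is_jacobian_on M F J"
    and seg: "closed_segment a b \<subseteq> M"
    and lip: "\<And>x. x \<in> closed_segment a b \<Longrightarrow> op_norm (J x - J a) \<le> \<Lambda> * norm (x - a)"
  shows "norm (F a - F b - J a *v (a - b)) \<le> \<Lambda> * (norm (a - b))\<^sup>2 / 2"
proof -
  define c where "c s = a + s *\<^sub>R (b - a)" for s :: real
  \<comment> \<open>With the linear part at \<open>a\<close> subtracted, the increment of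
    \<open>g\<close> over the unit interval is the remainder up to sign.\<close>
  define g where "g s = F (c s) - s *\<^sub>R (J a *v (b - a))" for s
  have c_in: "c s \<in> closed_segment a b" if "s \<in> {0..1}" for s
    using that unfolding c_def in_segment by (intro exI[of _ s]) (auto simp: algebra_simps)
  have g_deriv: "(g has_vector_derivative (J (c s) - J a) *v (b - a)) (at s within {0..1})"
    if s: "s \<in> {0..1}" for s
  proof -
    have c: "(c has_vector_derivative b - a) (at s within {0..1})"
      unfolding c_def by (auto intro!: derivative_eq_intros)
    have "c ` {0..1} \<subseteq> M"
      using c_in seg by blast
    moreover have "(F has_derivative (\<lambda>v. J (c s) *v v)) (at (c s) within M)"
      using J c_in[OF s] seg unfolding is_jacobian_on_def by blast
    \<comment> \<open>\<open>F\<close> is differentiable only within \<open>M\<close>, so the chain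
      rule is applied within the image of the path.\<close>
    ultimately have "(F has_derivative (\<lambda>v. J (c s) *v v)) (at (c s) within c ` {0..1})"
      using has_derivative_subset by blast
    from vector_derivative_diff_chain_within[OF c this]
    have "((\<lambda>s. F (c s)) has_vector_derivative J (c s) *v (b - a)) (at s within {0..1})"
      by (simp add: o_def)
    then show ?thesis
      unfolding g_def matrix_vector_mult_diff_rdistrib
      by (auto intro!: derivative_eq_intros)
  qed
  \<comment> \<open>An antiderivative of the bound on the derivative of \<open>g\<close> that
    \<open>lip\<close> provides.\<close>
  define \<phi> where "\<phi> s = \<Lambda> * (norm (b - a))\<^sup>2 * (s\<^sup>2 / 2)" for s :: real
  have "norm (g 1 - g 0) \<le> \<phi> 1 - \<phi> 0"
  proof (rule differentiable_bound_general)
    show "continuous_on {0..1} g"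
      using g_deriv by (rule continuous_on_vector_derivative)
    show "continuous_on {0..1} \<phi>"
      unfolding \<phi>_def by (intro continuous_intros) auto
    fix s :: real
    assume s: "0 < s" "s < 1"
    show "(g has_vector_derivative (J (c s) - J a) *v (b - a)) (at s)"
      using g_deriv[of s] s by (simp add: at_within_Icc_at)
    show "(\<phi> has_vector_derivative \<Lambda> * (norm (b - a))\<^sup>2 * s) (at s)"
      unfolding \<phi>_def has_real_derivative_iff_has_vector_derivative[symmetric]
      by (auto intro!: derivative_eq_intros)
    have "norm ((J (c s) - J a) *v (b - a)) \<le> \<Lambda> * norm (c s - a) * norm (b - a)"
      using s c_in[of s]
      by (intro order_trans[OF norm_matrix_vector_le_op_norm] mult_right_mono lip) auto
    then show "norm ((J (c s) - J a) *v (b - a)) \<le> \<Lambda> * (norm (b - a))\<^sup>2 * s"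
      using s by (simp add: c_def power2_eq_square mult_ac)
  qed simp
  moreover have "g 1 - g 0 = - (F a - F b - J a *v (a - b))"
    by (simp add: g_def c_def matrix_vector_mult_diff_distrib)
  ultimately show ?thesis
    by (simp only: norm_minus_cancel) (simp add: \<phi>_def norm_minus_commute)
qed

lemma is_jacobian_on_imp_continuous_on:
  "is_jacobian_on M F J \<Longrightarrow> continuous_on M F"
  unfolding is_jacobian_on_def by (meson has_derivative_continuous_on)

section \<open>Stability of the initial position under descriptor measurements\<close>

theorem proposition6:
  fixes M :: "(real ^ 'd::finite) set"
    and f :: "real ^ 'd \<Rightarrow> real ^ 'd \<Rightarrow> real"
    and dir :: "'n::finite \<Rightarrow> real ^ 'd"
    and F :: "real ^ 'd \<Rightarrow> real ^ 'n"
    and J :: "real ^ 'd \<Rightarrow> real ^ 'd ^ 'n"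
    and p q v :: "real \<Rightarrow> real ^ 'd"
    and \<epsilon> T L \<Lambda> \<mu> :: real
  assumes dim: "CARD('d) \<in> {2, 3}"
    and eps: "\<epsilon> > 0"
    and unit: "\<And>i. norm (dir i) = 1"
    and signal: "dominated_signal M f"
    and F: "F = descriptor_map \<epsilon> dir f"
    and J: "is_jacobian_on M F J"
    and T: "T > 0"
    and p_in: "\<And>t. t \<in> {0..T} \<Longrightarrow> p t \<in> M"
    and q_in: "\<And>t. t \<in> {0..T} \<Longrightarrow> q t \<in> M"
    and seg: "\<And>t. t \<in> {0..T} \<Longrightarrow> closed_segment (p t) (q t) \<subseteq> M"
    and v_cont: "continuous_on {0..T} v"
    and T1_p: "\<And>t. t \<in> {0..T} \<Longrightarrow> (p has_vector_derivative v t) (at t within {0..T})"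
    and T1_q: "\<And>t. t \<in> {0..T} \<Longrightarrow> (q has_vector_derivative v t) (at t within {0..T})"
    and T2: "\<And>t. t \<in> {0..T} \<Longrightarrow> op_norm (J (p t)) \<le> L"
    and T3: "\<And>t x y. t \<in> {0..T} \<Longrightarrow> x \<in> closed_segment (p t) (q t) \<Longrightarrow>
               y \<in> closed_segment (p t) (q t) \<Longrightarrow> op_norm (J x - J y) \<le> \<Lambda> * norm (x - y)"
    and T4: "lambda_min (gramian J p T) \<ge> \<mu>" "\<mu> > 0"
    and T5: "norm (p 0 - q 0) \<le> \<mu> / (\<Lambda> * L * T)"
  shows "norm (p 0 - q 0) \<le> 2 * L / \<mu> * integral {0..T} (\<lambda>t. norm (F (p t) - F (q t))) \<and>
         ((\<forall>t\<in>{0..T}. F (p t) = F (q t)) \<longrightarrow> p 0 = q 0)"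
proof -
  define \<delta> where "\<delta> = p 0 - q 0"
  define I where "I = integral {0..T} (\<lambda>t. norm (F (p t) - F (q t)))"
  have \<delta>: "p t - q t = \<delta>" if t: "t \<in> {0..T}" for t
  proof -
    have "((\<lambda>t. p t - q t) has_derivative (\<lambda>h. 0)) (at s within {0..T})" if "s \<in> {0..T}" for s
      using has_vector_derivative_diff[OF T1_p[OF that] T1_q[OF that]]
      by (simp add: has_vector_derivative_def)
    from has_derivative_zero_constant[OF convex_real_interval(5) this]
    obtain k where "\<And>s. s \<in> {0..T} \<Longrightarrow> p s - q s = k"
      by blast
    then show ?thesis
      using t T unfolding \<delta>_def by (metis atLeastAtMost_iff order_refl less_imp_le)
  qed
  have p_cont: "continuous_on {0..T} p" and q_cont: "continuous_on {0..T} q"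
    by (rule continuous_on_vector_derivative[OF T1_p] continuous_on_vector_derivative[OF T1_q]; assumption)+
  have F_cont: "continuous_on M F"
    by (rule is_jacobian_on_imp_continuous_on[OF J])
  have "continuous_on {0..T} (\<lambda>t. norm (F (p t) - F (q t)))"
    using p_in q_in
    by (intro continuous_intros continuous_on_compose2[OF F_cont] p_cont q_cont) auto
  then have I: "((\<lambda>t. norm (F (p t) - F (q t))) has_integral I) {0..T}"
    unfolding I_def by (intro integrable_integral integrable_continuous_interval)
  \<comment> \<open>No regularity of \<open>J\<close> along \<open>p\<close> is assumed;
    integrability is extracted from the positive eigenvalue bound (T4).\<close>
  have W: "(\<lambda>t. transpose (J (p t)) ** J (p t)) integrable_on {0..T}"
    using T4 by (intro gramian_integrable) linarith
  have pointwise: "(norm (J (p t) *v \<delta>))\<^sup>2 \<le>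
      L * norm \<delta> * (norm (F (p t) - F (q t)) + \<Lambda> * (norm \<delta>)\<^sup>2 / 2)" if t: "t \<in> {0..T}" for t
  proof -
    \<comment> \<open>The expansion is based at \<open>p t\<close>, so that its linear term contains
      the same Jacobian as the Gramian and (T2).\<close>
    have rem: "norm (F (p t) - F (q t) - J (p t) *v \<delta>) \<le> \<Lambda> * (norm \<delta>)\<^sup>2 / 2"
      using jacobian_taylor_remainder[OF J seg[OF t], of \<Lambda>] T3[OF t] \<delta>[OF t] by simp
    have "norm (J (p t) *v \<delta>) \<le>
        norm (F (p t) - F (q t)) + norm (F (p t) - F (q t) - J (p t) *v \<delta>)"
      by (metis norm_minus_commute norm_triangle_sub add.commute)
    then have 1: "norm (J (p t) *v \<delta>) \<le> norm (F (p t) - F (q t)) + \<Lambda> * (norm \<delta>)\<^sup>2 / 2"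
      using rem by linarith
    have 2: "norm (J (p t) *v \<delta>) \<le> L * norm \<delta>"
      using order_trans[OF norm_matrix_vector_le_op_norm mult_right_mono[OF T2[OF t] norm_ge_zero]] .
    \<comment> \<open>The two factors of the square are bounded differently, one by (T2) and one by
      Taylor. The measurement error thus enters linearly, and its plain integral \<open>I\<close>
      appears in the end.\<close>
    show ?thesis
      unfolding power2_eq_square[of "norm (J (p t) *v \<delta>)"]
      using mult_mono[OF 2 1] 2 norm_ge_zero[of "J (p t) *v \<delta>"] by linarith
  qed
  have "\<mu> * (norm \<delta>)\<^sup>2 \<le> lambda_min (gramian J p T) * (norm \<delta>)\<^sup>2"
    using T4 by (intro mult_right_mono) auto
  also have "\<dots> \<le> \<delta> \<bullet> (gramian J p T *v \<delta>)"
    by (rule lambda_min_le_quadratic_form[OF transpose_gramian[OF W]])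
  also have "\<dots> \<le> L * norm \<delta> * (I + \<Lambda> * (norm \<delta>)\<^sup>2 / 2 * T)"
  proof (rule has_integral_le[OF has_integral_gramian_quadratic_form[OF W] _ pointwise])
    have "((\<lambda>t. \<Lambda> * (norm \<delta>)\<^sup>2 / 2) has_integral \<Lambda> * (norm \<delta>)\<^sup>2 / 2 * T) {0..T}"
      using has_integral_const_real[of "\<Lambda> * (norm \<delta>)\<^sup>2 / 2" 0 T] T by (simp add: mult.commute)
    from has_integral_mult_right[OF has_integral_add[OF I this]]
    show "((\<lambda>t. L * norm \<delta> * (norm (F (p t) - F (q t)) + \<Lambda> * (norm \<delta>)\<^sup>2 / 2)) has_integral
        L * norm \<delta> * (I + \<Lambda> * (norm \<delta>)\<^sup>2 / 2 * T)) {0..T}" .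
  qed
  \<comment> \<open>A factor \<open>norm \<delta>\<close> is split off on both sides, to be
    cancelled once \<open>\<delta> \<noteq> 0\<close>.\<close>
  finally have main: "norm \<delta> * (\<mu> * norm \<delta>) \<le>
      norm \<delta> * (L * I + \<Lambda> * L * T * norm \<delta> * norm \<delta> / 2)"
    by (simp add: power2_eq_square algebra_simps)
  \<comment> \<open>An operator norm is nonnegative, so (T2) at time 0 fixes the sign of
    \<open>L\<close>.\<close>
  have L: "L \<ge> 0"
    using order_trans[OF onorm_pos_le[OF matrix_vector_mul_bounded_linear] T2[of 0]] T by simp
  have "I \<ge> 0"
    by (rule has_integral_nonneg[OF I]) simp
  have bound: "norm \<delta> \<le> 2 * L / \<mu> * I"
  proof (cases "\<delta> = 0")
    case True
    then show ?thesis
      using L \<open>I \<ge> 0\<close> T4(2) by simp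
  next
    case False
    then have pos: "norm \<delta> > 0"
      by simp
    then have "\<mu> / (\<Lambda> * L * T) > 0"
      using T5 unfolding \<delta>_def by linarith
    \<comment> \<open>In particular the denominator is nonzero, which excludes \<open>x / 0 = 0\<close> in (T5).\<close>
    then have "\<Lambda> * L * T > 0"
      using T4(2) by (simp add: zero_less_divide_iff)
    then have "\<Lambda> * L * T * norm \<delta> \<le> \<mu>"
      using T5 by (simp add: \<delta>_def pos_le_divide_eq mult.commute)
    then have "\<Lambda> * L * T * norm \<delta> * norm \<delta> \<le> \<mu> * norm \<delta>"
      by (intro mult_right_mono) auto
    moreover have "\<mu> * norm \<delta> \<le> L * I + \<Lambda> * L * T * norm \<delta> * norm \<delta> / 2"
      using main pos by (rule mult_left_le_imp_le)
    \<comment> \<open>The remainder is at most half of the left-hand side; absorbing it produces the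
      factor 2.\<close>
    ultimately have "\<mu> * norm \<delta> \<le> 2 * (L * I)"
      by linarith
    then show ?thesis
      using T4(2) by (simp add: field_simps)
  qed
  moreover have "p 0 = q 0" if "\<forall>t\<in>{0..T}. F (p t) = F (q t)"
  proof -
    have "I = integral {0..T} (\<lambda>t. 0)"
      unfolding I_def using that by (intro integral_cong) simp
    then show ?thesis
      using bound by (simp add: \<delta>_def)
  qed
  ultimately show ?thesis
    unfolding \<delta>_def I_def by blast
qed

end
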